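(* For any integers $1\le l<n$, let $S(n,l)$ be the set of words $w\in\mathfrak H^0$ with $|w|=n$ and $\ell(w)=l$. Then $\sum_{w\in S(n,l)}\zeta(w)$ is independent of $l$ (and, in particular, is equal to $\zeta(z_n)=\zeta(n)$).
   Context: Let $\mathbf Q\langle x,y\rangle$ be the algebra of polynomials over $\mathbf Q$ in noncommuting indeterminates $x,y$, with underlying graded vector space $\mathfrak H$ ($x$ and $y$ have degree 1). A word is a monomial in $x,y$; for a word $w$, $|w|$ is its total degree and $\ell(w)$ is the number of occurrences of $y$ in $w$. Set $\mathfrak H^0=\mathbf Q1\oplus x\mathfrak H y$ and $z_i=x^{i-1}y$. The $\mathbf Q$-linear map $\zeta:\mathfrak H^0\to\mathbf R$ is defined by $\zeta(1)=1$ and $\zeta(x^{k_1-1}yx^{k_2-1}y\cdots x^{k_l-1}y)=\zeta(k_1,\dots,k_l)$ for positive integers $k_1,\dots,k_l$ with $k_1>1$, where $$\zeta(k_1,\dots,k_l)=\sum_{n_1>n_2>\cdots>n_l\ge 1}\frac{1}{n_1^{k_1}\cdots n_l^{k_l}}.$$ *)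

theory Defs
  imports "HOL-Analysis.Analysis" "HOL-Library.Poly_Mapping"
begin

text \<open>Words are the free monoid on two letters (written additively, as required for the keys of
  a polynomial mapping), so that \<open>word \<Rightarrow>\<^sub>0 rat\<close> with the convolution product is the
  noncommutative polynomial algebra over the rationals.\<close>

datatype letter = X | Y

datatype word = Word (letters: "letter list")

instantiation word :: monoid_add
begin

definition zero_word :: word where
  "0 = Word []"

definition plus_word :: "word \<Rightarrow> word \<Rightarrow> word" where
  "u + v = Word (letters u @ letters v)"

instance
  by standard (simp_all add: zero_word_def plus_word_def)

end

type_synonym ncpoly = "word \<Rightarrow>\<^sub>0 rat"

definition word_degree :: "word \<Rightarrow> nat" where
  "word_degree w = length (letters w)"

definition y_degree :: "word \<Rightarrow> nat" where
  "y_degree w = count_list (letters w) Y"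

definition mon :: "word \<Rightarrow> ncpoly" where
  "mon w = Poly_Mapping.single w 1"

definition x\<^sub>H :: ncpoly where
  "x\<^sub>H = mon (Word [X])"

definition y\<^sub>H :: ncpoly where
  "y\<^sub>H = mon (Word [Y])"

definition H0 :: "ncpoly set" where
  "H0 = {Poly_Mapping.single 0 c + x\<^sub>H * h * y\<^sub>H | c h. True}"

definition z\<^sub>H :: "nat \<Rightarrow> ncpoly" where
  "z\<^sub>H i = x\<^sub>H ^ (i - 1) * y\<^sub>H"

text \<open>The summation ranges over all lists \<open>n\<^sub>1 > \<dots> > n\<^sub>l \<ge> 1\<close>. Since all terms are
  nonnegative, unconditional summation agrees with any other order of summation. The series converges
  when \<open>ks\<close> is empty (with value 1) or its first entry exceeds 1 and no entry is 0;
  in the divergent case \<open>infsum\<close> returns 0.\<close>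

definition mzv :: "nat list \<Rightarrow> real" where
  "mzv ks = (\<Sum>\<^sub>\<infinity>ns\<in>{ns :: nat list. length ns = length ks \<and> sorted_wrt (>) ns \<and> (\<forall>m\<in>set ns. m \<ge> 1)}.
     1 / (\<Prod>i<length ks. real (ns ! i) ^ (ks ! i)))"

text \<open>Decoding of \<open>x\<^bsup>k\<^sub>1-1\<^esup> y \<dots> x\<^bsup>k\<^sub>l-1\<^esup> y\<close> to \<open>[k\<^sub>1, \<dots>, k\<^sub>l]\<close>: the
  accumulator, initially 1, is one plus the number of letters \<open>x\<close> read since the last \<open>y\<close>.\<close>

fun decode :: "nat \<Rightarrow> letter list \<Rightarrow> nat list" where
  "decode k [] = []"
| "decode k (X # ls) = decode (Suc k) ls"
| "decode k (Y # ls) = k # decode 1 ls"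

text \<open>The \<open>\<rat>\<close>-linear map \<open>\<zeta>\<close>. It is meaningful on \<open>H0\<close> only; outside of
  \<open>H0\<close> its values are irrelevant.\<close>

definition zeta :: "ncpoly \<Rightarrow> real" where
  "zeta p = (\<Sum>w\<in>Poly_Mapping.keys p.
     of_rat (Poly_Mapping.lookup p w) * mzv (decode 1 (letters w)))"

definition S :: "nat \<Rightarrow> nat \<Rightarrow> word set" where
  "S n l = {w. mon w \<in> H0 \<and> word_degree w = n \<and> y_degree w = l}"

text \<open>The following facts characterise \<open>zeta\<close> on \<open>H0\<close>.\<close>

lemma zeta_superset:
  assumes "finite A" "Poly_Mapping.keys p \<subseteq> A"
  shows "zeta p = (\<Sum>w\<in>A. of_rat (Poly_Mapping.lookup p w) * mzv (decode 1 (letters w)))"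
  unfolding zeta_def using assms
  by (intro sum.mono_neutral_left) (auto simp: in_keys_iff)

lemma zeta_add: "zeta (p + q) = zeta p + zeta q"
proof -
  let ?A = "Poly_Mapping.keys p \<union> Poly_Mapping.keys q"
  have "Poly_Mapping.keys (p + q) \<subseteq> ?A"
    by (rule Poly_Mapping.keys_add)
  then show ?thesis
    using zeta_superset[of ?A p] zeta_superset[of ?A q] zeta_superset[of ?A "p + q"]
    by (simp add: lookup_add of_rat_add ring_distribs sum.distrib)
qed

lemma zeta_scale: "zeta (Poly_Mapping.single 0 c * p) = of_rat c * zeta p"
proof -
  have eq: "Poly_Mapping.single 0 c * p = Poly_Mapping.map ((*) c) p"
    by (simp add: mult_map_scale_conv_mult)
  have lk: "Poly_Mapping.lookup (Poly_Mapping.map ((*) c) p) w = c * Poly_Mapping.lookup p w" for w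
    by (simp add: map.rep_eq when_def)
  then have "Poly_Mapping.keys (Poly_Mapping.map ((*) c) p) \<subseteq> Poly_Mapping.keys p"
    by (auto simp: in_keys_iff)
  then show ?thesis
    unfolding eq
    using zeta_superset[of "Poly_Mapping.keys p" p]
      zeta_superset[of "Poly_Mapping.keys p" "Poly_Mapping.map ((*) c) p"]
    by (simp add: lk of_rat_mult sum_distrib_left mult.assoc)
qed

lemma zeta_mon: "zeta (mon w) = mzv (decode 1 (letters w))"
  by (simp add: zeta_def mon_def)

lemma mon_mult: "mon u * mon v = mon (u + v)"
  by (simp add: mon_def mult_single)

lemma z_eq_mon: "z\<^sub>H i = mon (Word (replicate (i - 1) X @ [Y]))"
proof -
  have "x\<^sub>H ^ m = mon (Word (replicate m X))" for m
    by (induction m) (simp_all add: x\<^sub>H_def mon_mult plus_word_def,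
        simp add: mon_def zero_word_def[symmetric])
  then show ?thesis
    by (simp add: z\<^sub>H_def y\<^sub>H_def mon_mult plus_word_def)
qed

lemma prod_z_eq_mon:
  "prod_list (map z\<^sub>H ks) = mon (Word (concat (map (\<lambda>k. replicate (k - 1) X @ [Y]) ks)))"
  by (induction ks)
    (simp_all add: z_eq_mon mon_mult plus_word_def, simp add: mon_def zero_word_def[symmetric])

lemma decode_block: "decode k (replicate m X @ Y # ls) = (k + m) # decode 1 ls"
  by (induction m arbitrary: k) simp_all

lemma decode_concat:
  assumes "\<forall>k\<in>set ks. k \<ge> 1"
  shows "decode 1 (concat (map (\<lambda>k. replicate (k - 1) X @ [Y]) ks)) = ks"
  using assms by (induction ks) (simp_all add: decode_block[of 1, simplified])

theorem zeta_prod_z: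
  assumes "\<forall>k\<in>set ks. k \<ge> 1"
  shows "zeta (prod_list (map z\<^sub>H ks)) = mzv ks"
  unfolding prod_z_eq_mon zeta_mon using decode_concat[OF assms] by simp

lemma zeta_one: "zeta 1 = 1"
proof -
  have "zeta 1 = mzv []"
    using zeta_prod_z[of "[]"] by simp
  also have "{ns :: nat list. length ns = length ([] :: nat list) \<and> sorted_wrt (>) ns \<and>
      (\<forall>m\<in>set ns. m \<ge> 1)} = {[]}"
    by auto
  then have "mzv [] = 1"
    unfolding mzv_def by simp
  finally show ?thesis .
qed

end

theory Submission
  imports Defs "HOL-Complex_Analysis.Cauchy_Integral_Formula"
begin

text \<open>
  The proof uses connected sums in the style of Seki and Yamamoto. For \<open>0 \<le> x < 1\<close>, expanding
  \<open>1 / (m - x)\<close> in powers of \<open>x\<close> (lemma \<open>has_sum_raised_mzv\<close>) gives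

  \<open>\<Sum> m\<^sub>1 > \<dots> > m\<^sub>l \<ge> 1. 1 / (m\<^sub>1 (m\<^sub>1 - x) (m\<^sub>2 - x) \<dots> (m\<^sub>l - x))
     = \<Sum> d. x ^ d * A d\<close>,

  where \<open>A d\<close> is the sum of all convergent multiple zeta values of depth \<open>l\<close> and weight
  \<open>l + 1 + d\<close>, and likewise

  \<open>\<Sum> n \<ge> 1. 1 / (n ^ l (n - x)) = \<Sum> d. x ^ d * \<zeta> (l + 1 + d)\<close>.

  So it is enough to see that the two left-hand sides agree for all such \<open>x\<close>; the coefficients
  then agree as well. With \<open>f n = (1 - x) \<dots> (n - x)\<close>, the connector
  \<open>C n m = f n f m / f (n + m)\<close> is symmetric, satisfies \<open>C n 0 = 1\<close>, and obeys the telescoping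
  relation (lemma \<open>has_sum_connector\<close>)

  \<open>\<Sum> m > a. C n m / (m - x) = C n a / n\<close> for \<open>n \<ge> 1\<close>.

  Starting from \<open>C n 0 = 1\<close> and applying this \<open>l\<close> times turns \<open>1 / n ^ l\<close> into a sum over
  \<open>0 < m\<^sub>l < \<dots> < m\<^sub>1\<close> of \<open>C n m\<^sub>1 / ((m\<^sub>1 - x) \<dots> (m\<^sub>l - x))\<close>. After multiplication by
  \<open>1 / (n - x)\<close>, the sum over \<open>n \<ge> 1\<close> is, by symmetry, another instance of the same relation and
  evaluates to \<open>C 0 m\<^sub>1 / m\<^sub>1 = 1 / m\<^sub>1\<close>. This is lemma \<open>sum_formula_generating_function\<close>. All terms are
  nonnegative, so every interchange of sums is legitimate.

  The remaining step is combinatorial: the words in \<open>S n l\<close> are in bijection with the indices of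
  depth \<open>l\<close> and weight \<open>n\<close> whose first entry exceeds 1.
\<close>

section \<open>The connector\<close>

text \<open>The quotient \<open>f n f m / f (n + m)\<close> for \<open>f n = (1 - x) (2 - x) \<dots> (n - x)\<close>, a
  deformation of an inverse binomial coefficient. It couples two independent nested sums, one with
  largest index \<open>n\<close> and one with largest index \<open>m\<close>.\<close>
definition connector :: "real \<Rightarrow> nat \<Rightarrow> nat \<Rightarrow> real" where
  "connector x n m = pochhammer (1 - x) n * pochhammer (1 - x) m / pochhammer (1 - x) (n + m)"

lemma connector_commute: "connector x n m = connector x m n"
  by (simp add: connector_def add.commute mult.commute)

lemma connector_pos: "x < 1 \<Longrightarrow> connector x n m > 0"
  by (simp add: connector_def pochhammer_pos)

lemma connector_0_right: "x < 1 \<Longrightarrow> connector x n 0 = 1"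
  using pochhammer_pos[of "1 - x" n] by (simp add: connector_def)

lemma connector_Suc_right:
  assumes "x < 1"
  shows "connector x n (Suc m) = connector x n m * (real (Suc m) - x) / (real (n + Suc m) - x)"
proof -
  have "pochhammer (1 - x) (n + Suc m) = pochhammer (1 - x) (n + m) * (real (n + Suc m) - x)"
    by (simp add: pochhammer_Suc algebra_simps)
  moreover have "pochhammer (1 - x) (Suc m) = pochhammer (1 - x) m * (real (Suc m) - x)"
    by (simp add: pochhammer_Suc algebra_simps)
  ultimately show ?thesis
    by (simp add: connector_def)
qed

text \<open>This is the identity that makes the method work: the ratio of consecutive connectors is
  \<open>connector x n m / connector x n (m + 1) = (n + m + 1 - x) / (m + 1 - x) = 1 + n / (m + 1 - x)\<close>,
  so that summing a connector against \<open>1 / (m - x)\<close> telescopes.\<close>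
lemma connector_difference:
  assumes "x < 1" "n \<ge> 1"
  shows "connector x n (Suc m) / (real (Suc m) - x) = (connector x n m - connector x n (Suc m)) / n"
proof -
  have nz: "real (Suc m) - x \<noteq> 0" "real n \<noteq> 0" "real (n + Suc m) - x \<noteq> 0"
    using assms by auto
  have "connector x n m = connector x n (Suc m) * (real (n + Suc m) - x) / (real (Suc m) - x)"
    unfolding connector_Suc_right[OF assms(1)] using nz by simp
  then have "connector x n m - connector x n (Suc m) = connector x n (Suc m) * n / (real (Suc m) - x)"
    using nz by (simp add: field_simps)
  then show ?thesis
    using nz by simp
qed

text \<open>For \<open>n = 1\<close> the connector is \<open>(1 - x) / (m + 1 - x)\<close>, and increasing \<open>n\<close> only multiplies it
  by further factors at most 1.\<close>
lemma connector_tendsto_0: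
  assumes "0 \<le> x" "x < 1" "n \<ge> 1"
  shows "connector x n \<longlonglongrightarrow> 0"
proof (rule tendsto_sandwich[where f = "\<lambda>_. 0"])
  have le: "connector x (Suc k) m \<le> (1 - x) / (real (Suc m) - x)" for k m
  proof (induction k)
    case 0
    have "connector x (Suc 0) m = connector x m (Suc 0)"
      by (rule connector_commute)
    also have "\<dots> = (1 - x) / (real (Suc m) - x)"
      using assms by (simp only: connector_Suc_right connector_0_right) simp
    finally show ?case by simp
  next
    case (Suc k)
    have "connector x (Suc (Suc k)) m
        = connector x (Suc k) m * ((real (Suc (Suc k)) - x) / (real (m + Suc (Suc k)) - x))"
      using connector_Suc_right[OF assms(2), of m "Suc k"] by (simp add: connector_commute[of x m])
    also have "\<dots> \<le> connector x (Suc k) m * 1"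
      by (intro mult_left_mono) (use assms connector_pos[of x "Suc k" m] in \<open>auto simp: divide_simps\<close>)
    finally show ?case using Suc by simp
  qed
  show "\<forall>\<^sub>F m in sequentially. connector x n m \<le> (1 - x) / (real (Suc m) - x)"
    using le[of "n - 1"] assms(3) by simp
  show "(\<lambda>m. (1 - x) / (real (Suc m) - x)) \<longlonglongrightarrow> 0"
    by real_asymp
qed (use connector_pos[OF assms(2)] in \<open>auto intro: less_imp_le always_eventually\<close>)

text \<open>The transport relation. Read from right to left it trades a factor \<open>1 / n\<close> on one side of the
  connector for a new summation index \<open>m\<close>, above the previous one \<open>a\<close>, with weight \<open>1 / (m - x)\<close>
  on the other side.\<close>
lemma has_sum_connector:
  assumes "0 \<le> x" "x < 1" "n \<ge> 1"
  shows "((\<lambda>m. connector x n m / (real m - x)) has_sum connector x n a / n) {a<..}"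
proof -
  have "(\<lambda>i. connector x n (i + a)) \<longlonglongrightarrow> 0"
    using LIMSEQ_ignore_initial_segment[OF connector_tendsto_0[OF assms]] by simp
  from telescope_sums'[OF this]
  have "(\<lambda>i. connector x n (i + a) - connector x n (Suc (i + a))) sums connector x n a"
    by simp
  from sums_divide[OF this, of "real n"]
  have "(\<lambda>i. connector x n (Suc (i + a)) / (real (Suc (i + a)) - x)) sums (connector x n a / n)"
    by (simp only: connector_difference[OF assms(2,3)])
  then have "((\<lambda>i. connector x n (Suc (i + a)) / (real (Suc (i + a)) - x)) has_sum connector x n a / n) UNIV"
    by (rule sums_nonneg_imp_has_sum) (use assms connector_pos[OF assms(2)] in \<open>auto intro!: divide_nonneg_nonneg less_imp_le\<close>)
  also have "?this \<longleftrightarrow> ?thesis"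
    by (rule has_sum_reindex_bij_witness[where i = "\<lambda>m. m - Suc a" and j = "\<lambda>i. Suc (i + a)"]) auto
  finally show ?thesis .
qed

section \<open>Transporting a power into a nested sum\<close>

definition descending :: "nat \<Rightarrow> nat list set" where
  "descending l = {ns. length ns = l \<and> sorted_wrt (>) ns \<and> (\<forall>m\<in>set ns. m \<ge> 1)}"

text \<open>The value 0 for the empty list makes the condition \<open>m > largest ns\<close> on a new index correct also
  for the first one, and fits \<open>connector x n 0 = 1\<close>.\<close>
definition largest :: "nat list \<Rightarrow> nat" where
  "largest ns = (case ns of [] \<Rightarrow> 0 | m # _ \<Rightarrow> m)"

lemma descending_0: "descending 0 = {[]}"
  by (auto simp: descending_def)

lemma Cons_in_descending:
  "m # ns \<in> descending (Suc l) \<longleftrightarrow> ns \<in> descending l \<and> m > largest ns"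
  by (cases ns) (auto simp: descending_def largest_def)

lemma has_sum_descending_Suc:
  "((\<lambda>ns. f ns) has_sum s) (descending (Suc l))
     \<longleftrightarrow> ((\<lambda>(ns, m). f (m # ns)) has_sum s) (SIGMA ns:descending l. {largest ns<..})"
proof (rule has_sum_reindex_bij_witness[where i = "\<lambda>(ns, m). m # ns" and j = "\<lambda>ns. (tl ns, hd ns)"])
  fix ns assume ns: "ns \<in> descending (Suc l)"
  then obtain m ns' where "ns = m # ns'"
    by (auto simp: descending_def length_Suc_conv)
  with ns show "(case (tl ns, hd ns) of (ns, m) \<Rightarrow> m # ns) = ns"
    "(tl ns, hd ns) \<in> (SIGMA ns:descending l. {largest ns<..})"
    "(case (tl ns, hd ns) of (ns, m) \<Rightarrow> f (m # ns)) = f ns"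
    by (auto simp: Cons_in_descending)
qed (auto simp: Cons_in_descending)

definition shifted_product :: "real \<Rightarrow> nat list \<Rightarrow> real" where
  "shifted_product x ns = prod_list (map (\<lambda>m. 1 / (real m - x)) ns)"

lemma shifted_product_nonneg:
  assumes "x < 1" "ns \<in> descending l"
  shows "shifted_product x ns \<ge> 0"
  using assms unfolding shifted_product_def descending_def by (auto intro!: prod_list_nonneg) force

text \<open>Each of the \<open>l\<close> factors of \<open>1 / n ^ l\<close> is transported in turn. The induction puts the new
  index at the head of the list, that is, above all earlier ones.\<close>
lemma has_sum_connector_descending:
  assumes "0 \<le> x" "x < 1" "n \<ge> 1"
  shows "((\<lambda>ns. connector x n (largest ns) * shifted_product x ns) has_sum 1 / real n ^ l) (descending l)"
proof (induction l)
  case 0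
  show ?case
    using has_sum_finite[of "{[]}" "\<lambda>ns. connector x n (largest ns) * shifted_product x ns"] assms
    by (simp add: descending_0 largest_def shifted_product_def connector_0_right)
next
  case (Suc l)
  let ?f = "\<lambda>(ns, m). connector x n m * shifted_product x (m # ns)"
  have inner: "((\<lambda>m. ?f (ns, m)) has_sum connector x n (largest ns) * shifted_product x ns / n)
      {largest ns<..}" for ns
    using has_sum_cmult_left[OF has_sum_connector[OF assms, of "largest ns"], of "shifted_product x ns"]
    by (simp add: shifted_product_def mult.assoc)
  have outer: "((\<lambda>ns. connector x n (largest ns) * shifted_product x ns / n) has_sum 1 / real n ^ Suc l)
      (descending l)"
    using has_sum_cmult_left[OF Suc, of "1 / n"] by (simp add: field_simps)
  have "?f summable_on (SIGMA ns:descending l. {largest ns<..})"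
  proof (rule summable_on_SigmaI[OF inner has_sum_imp_summable[OF outer]])
    fix ns m assume "ns \<in> descending l" "m \<in> {largest ns<..}"
    then have "m # ns \<in> descending (Suc l)"
      by (simp add: Cons_in_descending)
    then show "?f (ns, m) \<ge> 0"
      using shifted_product_nonneg[OF assms(2)] connector_pos[OF assms(2), of n m]
      by (simp add: less_imp_le)
  qed
  then have "(?f has_sum 1 / real n ^ Suc l) (SIGMA ns:descending l. {largest ns<..})"
    by (rule has_sum_SigmaI[OF inner outer])
  then show ?case
    by (subst has_sum_descending_Suc) (simp add: largest_def)
qed

text \<open>Fubini for nonnegative families: one convergent iterated sum gives the other, provided that the
  inner sums of the latter exist.\<close>
lemma has_sum_exchange:
  fixes f :: "'a \<Rightarrow> 'b \<Rightarrow> real"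
  assumes "\<And>a. a \<in> A \<Longrightarrow> (f a has_sum g a) B" and "(g has_sum s) A"
    and "\<And>b. b \<in> B \<Longrightarrow> ((\<lambda>a. f a b) has_sum h b) A"
    and "\<And>a b. a \<in> A \<Longrightarrow> b \<in> B \<Longrightarrow> f a b \<ge> 0"
  shows "(h has_sum s) B"
proof -
  let ?f = "\<lambda>(a, b). f a b"
  have inner: "((\<lambda>b. ?f (a, b)) has_sum g a) B" if "a \<in> A" for a
    using assms(1)[OF that] by simp
  have "?f summable_on A \<times> B"
    by (rule summable_on_SigmaI[OF inner has_sum_imp_summable[OF assms(2)]]) (use assms(4) in auto)
  with inner assms(2) have "(?f has_sum s) (A \<times> B)"
    by (rule has_sum_SigmaI)
  then have "((\<lambda>(b, a). f a b) has_sum s) (B \<times> A)"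
    by (subst (asm) has_sum_swap) simp
  then show ?thesis
    by (rule has_sum_SigmaD) (use assms(3) in simp)
qed

text \<open>The terms are dominated by \<open>1 / n\<^sup>2\<close>, up to the factor \<open>1 / (1 - x)\<close>, because
  \<open>n - x \<ge> n (1 - x)\<close> for \<open>n \<ge> 1\<close>.\<close>
lemma depth_one_summable:
  assumes "0 \<le> x" "x < 1" "l \<ge> 1"
  shows "(\<lambda>n. 1 / (real n ^ l * (real n - x))) summable_on {1..}"
proof (rule summable_on_comparison_test)
  have "summable (\<lambda>n. 1 / real n ^ 2)"
    using inverse_power_summable[of 2, where ?'a = real] by (simp add: inverse_eq_divide)
  then have "(\<lambda>n. 1 / real n ^ 2) summable_on UNIV"
    by (rule summable_nonneg_imp_summable_on) simp
  then have "(\<lambda>n. 1 / real n ^ 2) summable_on {1..}"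
    by (rule summable_on_subset_banach) simp
  then show "(\<lambda>n. 1 / real n ^ 2 * (1 / (1 - x))) summable_on {1..}"
    by (rule summable_on_cmult_left)
next
  fix n :: nat assume n: "n \<in> {1..}"
  have "x * 1 \<le> x * real n"
    using assms n by (intro mult_left_mono) auto
  then have "real n * (1 - x) \<le> real n - x"
    by (simp add: algebra_simps)
  moreover have "real n ^ 1 \<le> real n ^ l"
    using n assms by (intro power_increasing) auto
  ultimately have "real n ^ 1 * (real n * (1 - x)) \<le> real n ^ l * (real n - x)"
    using assms by (intro mult_mono) auto
  then have "1 / (real n ^ l * (real n - x)) \<le> 1 / (real n ^ 1 * (real n * (1 - x)))"
    using n assms by (intro divide_left_mono mult_pos_pos) auto
  then show "1 / (real n ^ l * (real n - x)) \<le> 1 / real n ^ 2 * (1 / (1 - x))"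
    by (simp add: power2_eq_square mult.assoc)
  show "0 \<le> 1 / (real n ^ l * (real n - x))"
    using n assms by auto
qed

text \<open>Both sides equal the connected double sum of
  \<open>connector x n (largest ns) * shifted_product x ns / (n - x)\<close> over \<open>n\<close> and \<open>ns\<close>. Summing over
  \<open>ns\<close> first transports all powers of \<open>n\<close>; summing over \<open>n\<close> first is a single transport step in
  the opposite direction, which removes \<open>n\<close> and leaves \<open>1 / largest ns\<close>.\<close>
lemma sum_formula_generating_function:
  assumes "0 \<le> x" "x < 1" "l \<ge> 1"
    and "((\<lambda>n. 1 / (real n ^ l * (real n - x))) has_sum s) {1..}"
  shows "((\<lambda>ns. shifted_product x ns / largest ns) has_sum s) (descending l)"
proof (rule has_sum_exchange)
  show "((\<lambda>n. 1 / (real n ^ l * (real n - x))) has_sum s) {1..}" by fact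
next
  fix n :: nat assume "n \<in> {1..}"
  then show "((\<lambda>ns. connector x n (largest ns) / (real n - x) * shifted_product x ns) has_sum
      1 / (real n ^ l * (real n - x))) (descending l)"
    using has_sum_cmult_left[OF has_sum_connector_descending[OF assms(1,2), of n l], of "1 / (real n - x)"]
    by (simp add: mult_ac)
next
  fix ns assume ns: "ns \<in> descending l"
  then have "largest ns \<ge> 1"
    using assms(3) by (cases ns) (auto simp: descending_def largest_def)
  from has_sum_cmult_left[OF has_sum_connector[OF assms(1,2) this, of 0], of "shifted_product x ns"]
  show "((\<lambda>n. connector x n (largest ns) / (real n - x) * shifted_product x ns) has_sum
      shifted_product x ns / largest ns) {1..}"
    using assms(2) by (simp add: connector_0_right connector_commute[of x _ "largest ns"]
        flip: atLeast_Suc_greaterThan)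
next
  fix n ns assume "n \<in> {1::nat..}" "ns \<in> descending l"
  then show "connector x n (largest ns) / (real n - x) * shifted_product x ns \<ge> 0"
    using connector_pos[OF assms(2), of n "largest ns"] shifted_product_nonneg[OF assms(2)] assms(2)
    by (auto intro!: mult_nonneg_nonneg divide_nonneg_nonneg)
qed

section \<open>Generating functions of multiple zeta values\<close>

definition power_product :: "nat list \<Rightarrow> nat list \<Rightarrow> real" where
  "power_product ks ns = prod_list (map2 (\<lambda>k m. real m ^ k) ks ns)"

lemma mzv_descending: "mzv ks = (\<Sum>\<^sub>\<infinity>ns\<in>descending (length ks). 1 / power_product ks ns)"
  unfolding mzv_def descending_def[symmetric]
  by (rule infsum_cong)
    (auto simp: descending_def power_product_def prod.list_conv_set_nth atLeast0LessThan intro!: prod.cong)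

text \<open>The geometric series of ratio \<open>x / m\<close>: the factor \<open>1 / (m - x)\<close> collects all ways to raise
  the exponent of \<open>m\<close>.\<close>
lemma has_sum_geometric_shift:
  assumes "0 \<le> x" "x < 1" "k \<ge> 1" "m \<ge> (1::nat)"
  shows "((\<lambda>e. x ^ e / real m ^ (k + e)) has_sum 1 / (real m ^ (k - 1) * (real m - x))) UNIV"
proof (rule sums_nonneg_imp_has_sum)
  have "(\<lambda>e. 1 / real m ^ k * (x / m) ^ e) sums (1 / real m ^ k * (1 / (1 - x / m)))"
    using assms by (intro sums_mult geometric_sums) auto
  moreover have "1 / real m ^ k * (x / m) ^ e = x ^ e / real m ^ (k + e)" for e
    by (simp add: power_divide power_add)
  moreover have "1 / real m ^ k * (1 / (1 - x / m)) = 1 / (real m ^ (k - 1) * (real m - x))"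
    using assms by (cases k) (auto simp: field_simps)
  ultimately show "(\<lambda>e. x ^ e / real m ^ (k + e)) sums (1 / (real m ^ (k - 1) * (real m - x)))"
    by simp
qed (use assms in auto)

lemma has_sum_lists_Suc:
  "(f has_sum s) {es. length es = Suc l}
     \<longleftrightarrow> ((\<lambda>(es, e). f (e # es)) has_sum s) ({es. length es = l} \<times> (UNIV :: 'a set))"
  by (rule has_sum_reindex_bij_witness[where i = "\<lambda>(es, e). e # es" and j = "\<lambda>es. (tl es, hd es)"])
    (auto simp: length_Suc_conv)

lemma has_sum_geometric_product:
  assumes "0 \<le> x" "x < 1"
    and "length ks = length ns" "\<forall>k\<in>set ks. k \<ge> 1" "\<forall>m\<in>set ns. m \<ge> 1"
  shows "((\<lambda>es. x ^ sum_list es / power_product (map2 (+) ks es) ns) has_sum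
      prod_list (map2 (\<lambda>k m. 1 / (real m ^ (k - 1) * (real m - x))) ks ns)) {es. length es = length ks}"
  using assms(3-)
proof (induction ks ns rule: list_induct2)
  case Nil
  show ?case
    using has_sum_finite[of "{[]}" "\<lambda>es. x ^ sum_list es / power_product (map2 (+) [] es) []"]
    by (simp add: power_product_def)
next
  case (Cons k ks m ns)
  let ?g = "\<lambda>k m. 1 / (real m ^ (k - 1) * (real m - x))"
  let ?h = "\<lambda>es. x ^ sum_list es / power_product (map2 (+) ks es) ns"
  let ?f = "\<lambda>(es, e). x ^ sum_list (e # es) / power_product (map2 (+) (k # ks) (e # es)) (m # ns)"
  have inner: "((\<lambda>e. ?f (es, e)) has_sum ?h es * ?g k m) UNIV" for es
    using has_sum_cmult_right[OF has_sum_geometric_shift[OF assms(1,2), of k m], of "?h es"] Cons.prems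
    by (simp add: power_product_def power_add mult_ac)
  have outer: "((\<lambda>es. ?h es * ?g k m) has_sum prod_list (map2 ?g (k # ks) (m # ns)))
      {es. length es = length ks}"
    using has_sum_cmult_left[OF Cons.IH, of "?g k m"] Cons.prems by (simp add: mult.commute)
  have "?f summable_on {es. length es = length ks} \<times> UNIV"
    by (rule summable_on_SigmaI[OF inner has_sum_imp_summable[OF outer]])
      (use assms(1) in \<open>auto simp: power_product_def intro!: divide_nonneg_nonneg mult_nonneg_nonneg prod_list_nonneg\<close>)
  from has_sum_SigmaI[OF inner outer this] show ?case
    unfolding list.size(4) add_0_right add_Suc_right by (subst has_sum_lists_Suc) simp
qed

lemma finite_compositions: "finite {es :: nat list. length es = l \<and> sum_list es = d}"
  by (rule finite_subset[OF _ finite_lists_length_eq[of "{..d}" l]]) (auto intro: member_le_sum_list)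

text \<open>Expanding every factor \<open>1 / (m - x)\<close> geometrically shows that the sum with shifted denominators
  is the generating function of the sums \<open>\<Sum> mzv (ks + es)\<close>, where \<open>es\<close> runs over the ways to
  distribute \<open>d\<close> additional units of weight among the entries of \<open>ks\<close>.
  Nonnegativity justifies the rearrangement.\<close>
lemma has_sum_raised_mzv:
  assumes "0 \<le> x" "x < 1" "\<forall>k\<in>set ks. k \<ge> 1"
    and "((\<lambda>ns. prod_list (map2 (\<lambda>k m. 1 / (real m ^ (k - 1) * (real m - x))) ks ns)) has_sum s)
           (descending (length ks))"
  shows "((\<lambda>d. (\<Sum>es | length es = length ks \<and> sum_list es = d. mzv (map2 (+) ks es)) * x ^ d)
           has_sum s) UNIV"
proof -
  let ?L = "{es :: nat list. length es = length ks}"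
  let ?f = "\<lambda>ns es. x ^ sum_list es / power_product (map2 (+) ks es) ns"
  let ?D = "descending (length ks)"
  have rows: "(?f ns has_sum prod_list (map2 (\<lambda>k m. 1 / (real m ^ (k - 1) * (real m - x))) ks ns)) ?L"
    if "ns \<in> ?D" for ns
    using that has_sum_geometric_product[OF assms(1,2) _ assms(3), of ns] by (auto simp: descending_def)
  have nonneg: "?f ns es \<ge> 0" for ns es
    using assms(1) by (auto simp: power_product_def intro!: divide_nonneg_nonneg prod_list_nonneg)
  have "(\<lambda>(ns, es). ?f ns es) summable_on ?D \<times> ?L"
    by (rule summable_on_SigmaI[OF _ has_sum_imp_summable[OF assms(4)]]) (use rows nonneg in auto)
  then have "(\<lambda>(es, ns). ?f ns es) summable_on ?L \<times> ?D"
    by (subst (asm) summable_on_swap) simp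
  then have columns_summable: "(\<lambda>ns. ?f ns es) summable_on ?D" if "es \<in> ?L" for es
    using summable_on_SigmaD1[of "\<lambda>es ns. ?f ns es" ?L "\<lambda>_. ?D" es] that by simp
  have columns: "((\<lambda>ns. ?f ns es) has_sum x ^ sum_list es * mzv (map2 (+) ks es)) ?D"
    if "es \<in> ?L" for es
  proof -
    have "(\<Sum>\<^sub>\<infinity>ns\<in>?D. ?f ns es)
        = (\<Sum>\<^sub>\<infinity>ns\<in>?D. x ^ sum_list es * (1 / power_product (map2 (+) ks es) ns))"
      by simp
    also have "\<dots> = x ^ sum_list es * (\<Sum>\<^sub>\<infinity>ns\<in>?D. 1 / power_product (map2 (+) ks es) ns)"
      by (rule infsum_cmult_right')
    also have "\<dots> = x ^ sum_list es * mzv (map2 (+) ks es)"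
      using that by (simp add: mzv_descending)
    finally have "(\<Sum>\<^sub>\<infinity>ns\<in>?D. ?f ns es) = x ^ sum_list es * mzv (map2 (+) ks es)" .
    with has_sum_infsum[OF columns_summable[OF that]] show ?thesis
      by simp
  qed
  (* Interchange the sums over es and ns, then group the es by their total d. *)
  have "((\<lambda>es. x ^ sum_list es * mzv (map2 (+) ks es)) has_sum s) ?L"
    by (rule has_sum_exchange[OF rows assms(4) columns nonneg])
  also have "?this \<longleftrightarrow> ((\<lambda>(d, es). x ^ d * mzv (map2 (+) ks es)) has_sum s)
      (SIGMA d:UNIV. {es. length es = length ks \<and> sum_list es = d})"
    by (rule has_sum_reindex_bij_witness[where i = snd and j = "\<lambda>es. (sum_list es, es)"]) auto
  finally show ?thesis
    by (rule has_sum_SigmaD)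
      (use finite_compositions in \<open>auto intro!: has_sum_finiteI simp: sum_distrib_left mult.commute\<close>)
qed

text \<open>Agreement to the right of 0 suffices, since the zeros of a nonzero power series are isolated.\<close>
lemma power_series_coeffs_eqI:
  fixes a b :: "nat \<Rightarrow> real"
  assumes "\<And>x. 0 \<le> x \<Longrightarrow> x < 1 \<Longrightarrow> \<exists>s. (\<lambda>n. a n * x ^ n) sums s \<and> (\<lambda>n. b n * x ^ n) sums s"
  shows "a = b"
proof -
  define c where "c = (\<lambda>n. a n - b n)"
  have zero: "(\<lambda>n. c n * x ^ n) sums 0" if x: "0 \<le> x" "x < 1" for x
  proof -
    obtain s where "(\<lambda>n. a n * x ^ n) sums s" "(\<lambda>n. b n * x ^ n) sums s"
      using assms[OF x] by blast
    from sums_diff[OF this] show ?thesis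
      by (simp add: c_def left_diff_distrib)
  qed
  have "c 0 = 0"
    by (rule sums_unique2[OF powser_sums_zero zero]) auto
  have conv: "(\<lambda>n. c n * x ^ n) sums suminf (\<lambda>n. c n * x ^ n)" if x: "norm x < 1" for x
  proof -
    obtain r where r: "norm x < r" "r < 1"
      using dense[OF x] by blast
    from r(1) have "0 \<le> r"
      using norm_ge_zero[of x] by linarith
    then have "summable (\<lambda>n. c n * r ^ n)"
      using r(2) by (intro sums_summable[OF zero])
    then show ?thesis
      by (rule summable_sums[OF powser_inside]) (use r in auto)
  qed
  have "c m = 0" for m
  proof (rule ccontr)
    assume m: "c m \<noteq> 0"
    with \<open>c 0 = 0\<close> have "m > 0"
      by (cases m) auto
    obtain s where s: "0 < s" "\<And>z. z \<in> cball 0 s - {0} \<Longrightarrow> suminf (\<lambda>n. c n * z ^ n) \<noteq> 0"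
    proof (rule powser_0_nonzero[of 1 0 c "\<lambda>x. suminf (\<lambda>n. c n * x ^ n)" m])
      show "suminf (\<lambda>n. c n * 0 ^ n) = 0"
        using zero[of 0] by (simp add: sums_iff)
    qed (use conv m \<open>m > 0\<close> in auto)
    (* A point of the punctured neighbourhood of 0 on which the series does vanish. *)
    define z where "z = min s (1 / 2)"
    have "0 < z" "z < 1" "z \<le> s"
      using s(1) by (auto simp: z_def)
    then show False
      using zero[of z] s(2)[of z] by (auto simp: sums_iff)
  qed
  then show ?thesis
    by (auto simp: c_def)
qed

text \<open>The indices of depth \<open>l\<close> and weight \<open>l + 1 + d\<close> whose first entry is at least 2 are exactly
  those obtained from the smallest one, \<open>(2, 1, \<dots>, 1)\<close>, by distributing \<open>d\<close> units of weight.
  The generating functions for the starting indices \<open>(2, 1, \<dots>, 1)\<close> and \<open>(l + 1)\<close> agree by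
  the connected sum, and the latter index has only one way to absorb \<open>d\<close> units.\<close>
lemma sum_raised_mzv:
  assumes "l \<ge> 1"
  shows "(\<Sum>es | length es = l \<and> sum_list es = d. mzv (map2 (+) (2 # replicate (l - 1) 1) es))
    = mzv [l + 1 + d]"
proof -
  let ?ks = "2 # replicate (l - 1) 1"
  let ?c = "\<lambda>ks d. \<Sum>es | length es = length ks \<and> sum_list es = d. mzv (map2 (+) ks es)"
  have "?c ?ks = ?c [l + 1]"
  proof (rule power_series_coeffs_eqI)
    fix x :: real assume x: "0 \<le> x" "x < 1"
    let ?g = "\<lambda>k m. 1 / (real m ^ (k - 1) * (real m - x))"
    obtain s where s: "((\<lambda>n. 1 / (real n ^ l * (real n - x))) has_sum s) {1..}"
      using depth_one_summable[OF x assms] summable_on_def by blast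
    also have "?this \<longleftrightarrow> ((\<lambda>ns. prod_list (map2 ?g [l + 1] ns)) has_sum s) (descending (length [l + 1]))"
      by (rule has_sum_reindex_bij_witness[where i = hd and j = "\<lambda>n. [n]"])
        (auto simp: descending_def length_Suc_conv)
    finally have "((\<lambda>d. ?c [l + 1] d * x ^ d) has_sum s) UNIV"
      by (intro has_sum_raised_mzv x) auto
    moreover have "prod_list (map2 ?g ?ks ns) = shifted_product x ns / largest ns"
      if "ns \<in> descending (length ?ks)" for ns
    proof -
      obtain m ns' where ns: "ns = m # ns'" "length ns' = l - 1"
        using \<open>ns \<in> descending (length ?ks)\<close> by (auto simp: descending_def length_Suc_conv)
      have "map2 ?g (replicate (length ns') 1) ns' = map (\<lambda>m. 1 / (real m - x)) ns'" for ns'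
        by (induction ns') auto
      from this[of ns'] show ?thesis
        by (simp add: ns shifted_product_def largest_def)
    qed
    then have "((\<lambda>ns. prod_list (map2 ?g ?ks ns)) has_sum s) (descending (length ?ks))"
      using sum_formula_generating_function[OF x assms s] assms
      by (subst has_sum_cong) auto
    then have "((\<lambda>d. ?c ?ks d * x ^ d) has_sum s) UNIV"
      by (intro has_sum_raised_mzv x) auto
    ultimately show "\<exists>s. (\<lambda>d. ?c ?ks d * x ^ d) sums s \<and> (\<lambda>d. ?c [l + 1] d * x ^ d) sums s"
      using has_sum_imp_sums by blast
  qed
  then have "?c ?ks d = ?c [l + 1] d"
    by metis
  moreover have "{es. length es = length [l + 1] \<and> sum_list es = d} = {[d]}"
    by (auto simp: length_Suc_conv)
  ultimately show ?thesis
    using assms by simp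
qed

section \<open>Words and indices\<close>

lemma mon_in_H0_iff: "mon w \<in> H0 \<longleftrightarrow> w = 0 \<or> (\<exists>u. w = Word (X # u @ [Y]))"
proof
  assume "mon w \<in> H0"
  then obtain c h where eq: "mon w = Poly_Mapping.single 0 c + x\<^sub>H * h * y\<^sub>H"
    by (auto simp: H0_def)
  have "Poly_Mapping.keys (x\<^sub>H * h * y\<^sub>H) \<subseteq> {Word [X] + u + Word [Y] | u. True}"
    using keys_mult[of "x\<^sub>H * h" "y\<^sub>H"] keys_mult[of "x\<^sub>H" h]
    by (fastforce simp: x\<^sub>H_def y\<^sub>H_def mon_def)
  moreover have "w \<in> Poly_Mapping.keys (mon w)"
    by (simp add: mon_def)
  then have "w \<in> {0} \<union> Poly_Mapping.keys (x\<^sub>H * h * y\<^sub>H)"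
    using Poly_Mapping.keys_add[of "Poly_Mapping.single 0 c" "x\<^sub>H * h * y\<^sub>H"]
    unfolding eq by (auto split: if_splits)
  ultimately show "w = 0 \<or> (\<exists>u. w = Word (X # u @ [Y]))"
    by (auto simp: plus_word_def)
next
  assume "w = 0 \<or> (\<exists>u. w = Word (X # u @ [Y]))"
  then show "mon w \<in> H0"
  proof
    assume "w = 0"
    then have "mon w = Poly_Mapping.single 0 1 + x\<^sub>H * 0 * y\<^sub>H"
      by (simp add: mon_def)
    then show ?thesis
      unfolding H0_def by blast
  next
    assume "\<exists>u. w = Word (X # u @ [Y])"
    then obtain u where "w = Word (X # u @ [Y])" ..
    then have "mon w = Poly_Mapping.single 0 0 + x\<^sub>H * mon (Word u) * y\<^sub>H"
      by (simp add: x\<^sub>H_def y\<^sub>H_def mon_mult plus_word_def)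
    then show ?thesis
      unfolding H0_def by blast
  qed
qed

abbreviation encode :: "nat list \<Rightarrow> letter list" where
  "encode ks \<equiv> concat (map (\<lambda>k. replicate (k - 1) X @ [Y]) ks)"

text \<open>The final letter \<open>Y\<close> is essential: letters \<open>X\<close> after the last \<open>Y\<close> are lost in decoding.\<close>
lemma encode_decode:
  "k \<ge> 1 \<Longrightarrow> encode (decode k (u @ [Y])) = replicate (k - 1) X @ u @ [Y]"
proof (induction k u rule: decode.induct)
  case (2 k ls)
  then show ?case
    by (cases k) (simp_all add: replicate_app_Cons_same)
qed auto

lemma decode_ge_1: "k \<ge> 1 \<Longrightarrow> \<forall>i\<in>set (decode k ls). i \<ge> 1"
  by (induction k ls rule: decode.induct) auto

lemma length_decode: "length (decode k ls) = count_list ls Y"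
  by (induction k ls rule: decode.induct) auto

lemma sum_list_decode: "k \<ge> 1 \<Longrightarrow> sum_list (decode k (u @ [Y])) + 1 = length (u @ [Y]) + k"
  by (induction k u rule: decode.induct) auto

lemma hd_decode: "hd (decode k (u @ [Y])) \<ge> k"
  by (induction k u rule: decode.induct) auto

text \<open>A word corresponds to its index; beginning with \<open>X\<close> means that the first entry is at least 2,
  and ending with \<open>Y\<close> makes the decoding faithful. Words of \<open>S n l\<close> have both properties because
  \<open>l < n\<close> excludes the empty word.\<close>
lemma bij_betw_decode:
  assumes "1 \<le> l" "l < n"
  shows "bij_betw (\<lambda>w. decode 1 (letters w)) (S n l)
    {ks. length ks = l \<and> sum_list ks = n \<and> (\<forall>k\<in>set ks. k \<ge> 1) \<and> hd ks \<ge> 2}"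
    (is "bij_betw _ _ ?I")
proof (rule bij_betwI[where g = "\<lambda>ks. Word (encode ks)"])
  have S_form: "\<exists>u. w = Word (X # u @ [Y])" if "w \<in> S n l" for w
    using that assms by (auto simp: S_def mon_in_H0_iff word_degree_def zero_word_def)
  show "(\<lambda>w. decode 1 (letters w)) \<in> S n l \<rightarrow> ?I"
  proof
    fix w assume w: "w \<in> S n l"
    then obtain u where u: "w = Word (X # u @ [Y])"
      using S_form by blast
    have "length (decode 1 (letters w)) = l"
      using w by (simp add: length_decode S_def y_degree_def)
    moreover have "sum_list (decode 1 (letters w)) = n"
      using w sum_list_decode[of 1 "X # u"] by (simp add: u S_def word_degree_def)
    moreover have "hd (decode 1 (letters w)) \<ge> 2"
      using hd_decode[of 2 u] by (simp add: u numeral_2_eq_2)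
    ultimately show "decode 1 (letters w) \<in> ?I"
      using decode_ge_1[of 1 "letters w"] by simp
  qed
  show "Word (encode (decode 1 (letters w))) = w" if w: "w \<in> S n l" for w
  proof -
    obtain u where "w = Word (X # u @ [Y])"
      using S_form w by blast
    then show ?thesis
      using encode_decode[of 1 "X # u"] by simp
  qed
  show dec: "decode 1 (letters (Word (encode ks))) = ks" if "ks \<in> ?I" for ks
    using that decode_concat[of ks] by simp
  show "(\<lambda>ks. Word (encode ks)) \<in> ?I \<rightarrow> S n l"
  proof
    fix ks assume ks: "ks \<in> ?I"
    with assms have "ks \<noteq> []"
      by auto
    then obtain v where v: "encode ks = v @ [Y]"
      by (cases ks rule: rev_cases) auto
    have "\<exists>v'. encode ks = X # v'"
    proof -
      obtain k ks' where k: "ks = k # ks'"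
        using \<open>ks \<noteq> []\<close> by (cases ks) auto
      with ks have "k - 1 = Suc (k - 2)"
        by auto
      then show ?thesis
        by (simp add: k)
    qed
    then obtain u where "encode ks = X # u @ [Y]"
      using v by (cases v) auto
    then have "mon (Word (encode ks)) \<in> H0"
      by (simp add: mon_in_H0_iff)
    moreover have "sum_list (decode 1 (encode ks)) + 1 = length (encode ks) + 1"
      unfolding v by (rule sum_list_decode) simp
    then have "word_degree (Word (encode ks)) = n"
      using ks dec[OF ks] by (simp add: word_degree_def)
    moreover have "y_degree (Word (encode ks)) = l"
      using ks dec[OF ks] length_decode[of 1 "encode ks"] by (simp add: y_degree_def)
    ultimately show "Word (encode ks) \<in> S n l"
      by (simp add: S_def)
  qed
qed

lemma map2_plus_ones: "map2 (+) (replicate (length es) 1) es = map Suc es"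
  by (induction es) auto

lemma bij_betw_raise:
  assumes "l \<ge> 1"
  shows "bij_betw (map2 (+) (2 # replicate (l - 1) 1)) {es. length es = l \<and> sum_list es = d}
    {ks. length ks = l \<and> sum_list ks = l + 1 + d \<and> (\<forall>k\<in>set ks. k \<ge> 1) \<and> hd ks \<ge> 2}"
    (is "bij_betw ?f ?E ?I")
proof -
  obtain l' where l: "l = Suc l'"
    using assms by (cases l) auto
  have f: "?f (e # es) = (e + 2) # map Suc es" if "length es = l'" for e es
    using map2_plus_ones[of es] that by (simp add: l)
  have sum_Suc: "sum_list (map Suc es) = sum_list es + length es" for es
    by (induction es) auto
  have Suc_pred: "map Suc (map (\<lambda>k. k - 1) ks) = ks" if "\<forall>k\<in>set ks. k \<ge> 1" for ks
    using that by (induction ks) auto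
  show ?thesis
  proof (rule bij_betwI[where g = "\<lambda>ks. (hd ks - 2) # map (\<lambda>k. k - 1) (tl ks)"])
    show "?f \<in> ?E \<rightarrow> ?I"
    proof
      fix es assume "es \<in> ?E"
      then obtain e es' where "es = e # es'" "length es' = l'" "e + sum_list es' = d"
        by (auto simp: l length_Suc_conv)
      then show "?f es \<in> ?I"
        using f[of es' e] by (auto simp: l sum_Suc)
    qed
    have split: "\<exists>k ks'. ks = (k + 2) # ks' \<and> length ks' = l' \<and> (\<forall>k\<in>set ks'. k \<ge> 1)
        \<and> k + sum_list ks' = l' + d" if ks: "ks \<in> ?I" for ks
    proof -
      obtain k ks' where "ks = k # ks'" "length ks' = l'"
        using ks by (cases ks) (auto simp: l)
      with ks show ?thesis
        by (intro exI[of _ "k - 2"] exI[of _ ks']) (auto simp: l)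
    qed
    show "(\<lambda>ks. (hd ks - 2) # map (\<lambda>k. k - 1) (tl ks)) \<in> ?I \<rightarrow> ?E"
    proof
      fix ks assume "ks \<in> ?I"
      then obtain k ks' where ks: "ks = (k + 2) # ks'" "length ks' = l'" "\<forall>k\<in>set ks'. k \<ge> 1"
        "k + sum_list ks' = l' + d"
        using split by blast
      have "sum_list ks' = sum_list (map (\<lambda>k. k - 1) ks') + l'"
        using sum_Suc[of "map (\<lambda>k. k - 1) ks'"] Suc_pred[OF ks(3)] ks(2) by simp
      then show "(hd ks - 2) # map (\<lambda>k. k - 1) (tl ks) \<in> ?E"
        using ks by (simp add: l)
    qed
    show "(hd (?f es) - 2) # map (\<lambda>k. k - 1) (tl (?f es)) = es" if es: "es \<in> ?E" for es
    proof -
      obtain e es' where "es = e # es'" "length es' = l'"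
        using es by (auto simp: l length_Suc_conv)
      then show ?thesis
        using f[of es' e] by (simp add: o_def)
    qed
    show "?f ((hd ks - 2) # map (\<lambda>k. k - 1) (tl ks)) = ks" if ks: "ks \<in> ?I" for ks
    proof -
      obtain k ks' where "ks = (k + 2) # ks'" "length ks' = l'" "\<forall>k\<in>set ks'. k \<ge> 1"
        using split[OF ks] by blast
      then show ?thesis
        using f[of "map (\<lambda>k. k - 1) ks'" k] Suc_pred[of ks'] by simp
    qed
  qed
qed

section \<open>The sum formula\<close>

lemma sum_zeta_S:
  assumes "1 \<le> l" "l < n"
  shows "(\<Sum>w\<in>S n l. zeta (mon w)) = mzv [n]"
proof -
  define d where "d = n - l - 1"
  have n: "n = l + 1 + d"
    using assms by (simp add: d_def)
  have "(\<Sum>w\<in>S n l. zeta (mon w))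
      = (\<Sum>ks | length ks = l \<and> sum_list ks = n \<and> (\<forall>k\<in>set ks. k \<ge> 1) \<and> hd ks \<ge> 2. mzv ks)"
    unfolding zeta_mon by (rule sum.reindex_bij_betw[OF bij_betw_decode[OF assms]])
  also have "\<dots> = (\<Sum>es | length es = l \<and> sum_list es = d. mzv (map2 (+) (2 # replicate (l - 1) 1) es))"
    unfolding n by (rule sum.reindex_bij_betw[OF bij_betw_raise[OF assms(1)], symmetric])
  also have "\<dots> = mzv [n]"
    unfolding n by (rule sum_raised_mzv[OF assms(1)])
  finally show ?thesis .
qed

theorem corollary2p4:
  fixes n :: nat
  shows "(\<forall>l l'. 1 \<le> l \<and> l < n \<and> 1 \<le> l' \<and> l' < n \<longrightarrow>
            (\<Sum>w\<in>S n l. zeta (mon w)) = (\<Sum>w\<in>S n l'. zeta (mon w)))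
       \<and> (\<forall>l. 1 \<le> l \<and> l < n \<longrightarrow>
            (\<Sum>w\<in>S n l. zeta (mon w)) = zeta (z\<^sub>H n) \<and> zeta (z\<^sub>H n) = mzv [n])"
proof -
  have "zeta (z\<^sub>H n) = mzv [n]" if "n \<ge> 1"
    using zeta_prod_z[of "[n]"] that by simp
  then show ?thesis
    using sum_zeta_S by auto
qed

end
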